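(* Let $h>0$ be real and $d\ge 4$ an integer such that there exists a Hadamard matrix of order $d$. Then there exist a positive definite matrix $\Lambda\in\mathbb{R}^{d\times d}$ and $n=2d$ vectors $v_1,\dots,v_{2d}\in\mathbb{R}^d$ such that $\max_{i\in[2d]}v_i^\top\Lambda^{-1}v_i=\max(h,4)$ and, for the cardinality constraint $k=d$, every output $S_{\mathrm{greedy}}$ of the greedy algorithm (with arbitrary tie-breaking) satisfies $$\frac{f(S_{\mathrm{greedy}})}{f(S^\star)}\ge\frac{1+h}{5},$$ where $f(S)=\mathrm{tr}\big((\Lambda+\sum_{i\in S}v_iv_i^\top)^{-1}\big)$ for $S\subseteq[2d]$ and $S^\star$ is a minimizer of $f$ over all $S\subseteq[2d]$ with $|S|=d$.
   Context: Notation: $[m]=\{1,\dots,m\}$. A Hadamard matrix of order $d$ is a $d\times d$ matrix $H$ with all entries $\pm1$ and $HH^\top=dI_d$. Greedy algorithm with budget $k$ on vectors $v_1,\dots,v_n$: set $S_0=\emptyset$; for $t=1,\dots,k$ choose any $i_t\in\arg\min_{i\in[n]\setminus S_{t-1}}f(S_{t-1}\cup\{i\})$ and set $S_t=S_{t-1}\cup\{i_t\}$; return $S_{\mathrm{greedy}}=S_k$. The result is required to hold for every choice of tie-breaking in the $\arg\min$. *)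

theory Defs
  imports "HOL-Analysis.Analysis"
begin

definition hadamard_matrix :: "real^'d^'d \<Rightarrow> bool" where
  "hadamard_matrix H \<longleftrightarrow>
     (\<forall>i j. H $ i $ j = 1 \<or> H $ i $ j = -1) \<and>
     H ** transpose H = mat (real CARD('d))"

text \<open>Symmetry is part of positive definiteness.\<close>

definition pos_def :: "real^'d^'d \<Rightarrow> bool" where
  "pos_def A \<longleftrightarrow> transpose A = A \<and> (\<forall>x. x \<noteq> 0 \<longrightarrow> x \<bullet> (A *v x) > 0)"

definition outer_prod :: "real^'d \<Rightarrow> real^'d^'d" where
  "outer_prod x = (columnvector x :: real^1^'d) ** (rowvector x :: real^'d^1)"

definition design_cost :: "real^'d^'d \<Rightarrow> ('i \<Rightarrow> real^'d) \<Rightarrow> 'i set \<Rightarrow> real" where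
  "design_cost \<Lambda> v S = trace (matrix_inv (\<Lambda> + (\<Sum>i\<in>S. outer_prod (v i))))"

text \<open>\<open>greedy_run f N t S\<close>: the greedy algorithm minimizing \<open>f\<close> over the ground set \<open>N\<close>
  can hold the set \<open>S\<close> after \<open>t\<close> steps, for some way of breaking ties.\<close>

inductive greedy_run :: "('i set \<Rightarrow> real) \<Rightarrow> 'i set \<Rightarrow> nat \<Rightarrow> 'i set \<Rightarrow> bool"
  for f :: "'i set \<Rightarrow> real" and N :: "'i set" where
  init: "greedy_run f N 0 {}"
| step: "greedy_run f N t S \<Longrightarrow> is_arg_min (\<lambda>j. f (S \<union> {j})) (\<lambda>j. j \<in> N - S) i
    \<Longrightarrow> greedy_run f N (Suc t) (S \<union> {i})"

end

theory Submission
  imports Defs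
begin

text \<open>In the coordinates \<open>w = \<Lambda>\<^sup>-\<^sup>1\<^sup>/\<^sup>2 v\<close> the instance consists of the vectors \<open>2 e\<^sub>k\<close> and
  of the columns of \<open>H\<close> scaled to squared length \<open>h\<close>, while \<open>\<Lambda>\<^sup>-\<^sup>1\<close> is diagonal with the slowly
  decreasing entries \<open>2d - 2, \<dots>, d - 1\<close>. Each of the two families is an orthogonal basis, so that
  all Hadamard vectors together cost \<open>tr \<Lambda>\<^sup>-\<^sup>1 / (1 + h)\<close> and all axis vectors \<open>tr \<Lambda>\<^sup>-\<^sup>1 / 5\<close>. As a
  Hadamard vector spreads evenly over all coordinates, its marginal gain stays below
  that of the best remaining axis vector, whatever \<open>h\<close> is: greedy takes the axis vectors in order.\<close>

section \<open>Diagonal matrices and their rank-one updates\<close>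

definition diag_mat :: "('d \<Rightarrow> real) \<Rightarrow> real^'d^'d" where
  "diag_mat m = (\<chi> i j. if i = j then m i else 0)"

lemma outer_prod_nth [simp]: "outer_prod x $ i $ j = x $ i * x $ j"
  by (simp add: outer_prod_def matrix_matrix_mult_def columnvector_def rowvector_def)

lemma diag_mat_nth [simp]: "diag_mat m $ i $ j = (if i = j then m i else 0)"
  by (simp add: diag_mat_def)

lemma diag_mat_mult_vec: "(diag_mat m *v x) $ i = m i * (x $ i :: real)"
  by (simp add: matrix_vector_mult_def if_distrib [of "\<lambda>z. z * _"] cong: if_cong)

text \<open>For square matrices a right inverse is two-sided, and a two-sided inverse is unique, so
  the choice made by \<open>matrix_inv\<close> is determined.\<close>

lemma matrix_inv_eqI:
  fixes A B :: "real^'n^'n"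
  assumes "A ** B = mat 1"
  shows "matrix_inv A = B"
proof -
  have "A ** B = mat 1 \<and> B ** A = mat 1"
    using assms matrix_left_right_inverse by blast
  then have "matrix_inv A ** A = mat 1"
    unfolding matrix_inv_def by (rule someI2) blast
  then show ?thesis
    by (metis assms matrix_mul_assoc matrix_mul_lid matrix_mul_rid)
qed

lemma matrix_inv_diag_mat:
  fixes m :: "'d::finite \<Rightarrow> real"
  assumes "\<And>k. m k > 0"
  shows "matrix_inv (diag_mat m) = diag_mat (\<lambda>k. 1 / m k)"
proof (rule matrix_inv_eqI)
  show "diag_mat m ** diag_mat (\<lambda>k. 1 / m k) = mat 1"
    using less_imp_neq [OF assms, symmetric]
    by (simp add: vec_eq_iff matrix_matrix_mult_def mat_def if_distrib [of "\<lambda>z. z * _"] cong: if_cong)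
qed

text \<open>The subtracted quotient is the marginal gain of \<open>w\<close> on a diagonal design.
  Designs made of axis vectors are diagonal, so this prices a Hadamard vector at each greedy
  step.\<close>

lemma sherman_morrison_trace_diag_mat:
  fixes m :: "'d::finite \<Rightarrow> real"
  assumes m: "\<And>k. m k > 0"
  shows "trace (matrix_inv (diag_mat m + outer_prod w)) =
    (\<Sum>k\<in>UNIV. 1 / m k) - (\<Sum>k\<in>UNIV. (w $ k / m k)\<^sup>2) / (1 + (\<Sum>k\<in>UNIV. (w $ k)\<^sup>2 / m k))"
proof -
  define q where "q = (\<Sum>k\<in>UNIV. (w $ k)\<^sup>2 / m k)"
  have q: "1 + q > 0"
    using m unfolding q_def by (smt (verit) divide_nonneg_pos sum_nonneg zero_le_power2)
  \<comment> \<open>With D the diagonal matrix, this is D^-1 - (D^-1 w)(D^-1 w)^T / (1 + q), where q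
    = w^T D^-1 w.\<close>
  define B :: "real^'d^'d" where
    "B = (\<chi> i j. (if i = j then 1 / m i else 0) - (w $ i / m i) * (w $ j / m j) / (1 + q))"
  have "((diag_mat m + outer_prod w) ** B) $ i $ j = mat 1 $ i $ j" for i j
  proof -
    have "((diag_mat m + outer_prod w) ** B) $ i $ j =
        m i * B $ i $ j + w $ i * (\<Sum>k\<in>UNIV. w $ k * B $ k $ j)"
      by (simp add: matrix_matrix_mult_def distrib_right sum.distrib sum_distrib_left mult.assoc
          if_distrib [of "\<lambda>z. z * _"] cong: if_cong)
    also have "(\<Sum>k\<in>UNIV. w $ k * B $ k $ j) =
        (\<Sum>k\<in>UNIV. (if k = j then w $ j / m j else 0) - (w $ k)\<^sup>2 / m k * (w $ j / m j / (1 + q)))"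
      by (intro sum.cong) (auto simp: B_def power2_eq_square right_diff_distrib)
    also have "\<dots> = w $ j / m j - q * (w $ j / m j / (1 + q))"
      unfolding sum_subtractf sum_distrib_right [symmetric] q_def [symmetric] by simp
    also have "\<dots> = w $ j / m j / (1 + q)"
      using q by (simp add: divide_simps) (simp add: algebra_simps)
    finally show ?thesis
      using m [of i] by (auto simp: B_def mat_def right_diff_distrib)
  qed
  then have "(diag_mat m + outer_prod w) ** B = mat 1"
    unfolding vec_eq_iff by blast
  then have "matrix_inv (diag_mat m + outer_prod w) = B"
    by (rule matrix_inv_eqI)
  then show ?thesis
    by (simp add: trace_def B_def sum_subtractf sum_divide_distrib power2_eq_square q_def)
qed

section \<open>Positive definiteness and the sign of the cost\<close>

lemma pos_def_diag_mat:
  fixes m :: "'d::finite \<Rightarrow> real"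
  assumes m: "\<And>k. m k > 0"
  shows "pos_def (diag_mat m)"
  unfolding pos_def_def
proof (intro conjI allI impI)
  show "transpose (diag_mat m) = diag_mat m"
    by (auto simp: vec_eq_iff transpose_def)
  fix x :: "real^'d" assume "x \<noteq> 0"
  then obtain k where k: "x $ k \<noteq> 0" by (auto simp: vec_eq_iff)
  have "x \<bullet> (diag_mat m *v x) = (\<Sum>i\<in>UNIV. m i * (x $ i)\<^sup>2)"
    by (simp add: inner_vec_def diag_mat_mult_vec power2_eq_square mult_ac)
  also have "\<dots> > 0"
    using k m by (intro sum_pos2 [where i = k]) (auto simp: less_imp_le)
  finally show "x \<bullet> (diag_mat m *v x) > 0" .
qed

text \<open>Each summand has a square, (v i . x)^2, as its quadratic form.\<close>

lemma pos_def_add_outer_prods: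
  fixes A :: "real^'d^'d::finite"
  assumes "pos_def A"
  shows "pos_def (A + (\<Sum>i\<in>S. outer_prod (v i)))"
proof (cases "finite S")
  case True
  then show ?thesis
  proof (induction S)
    case empty
    then show ?case using assms by simp
  next
    case (insert a S)
    let ?B = "A + (\<Sum>i\<in>S. outer_prod (v i))"
    have *: "x \<bullet> (outer_prod (v a) *v x) = (v a \<bullet> x)\<^sup>2" for x
      by (simp add: inner_vec_def matrix_vector_mult_def power2_eq_square sum_product
          sum_distrib_left mult_ac)
    have "transpose (?B + outer_prod (v a)) = ?B + outer_prod (v a)"
      using insert.IH by (simp add: pos_def_def transpose_def vec_eq_iff mult.commute)
    moreover have "x \<bullet> ((?B + outer_prod (v a)) *v x) > 0" if "x \<noteq> 0" for x
      using insert.IH that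
      by (simp add: matrix_vector_mult_add_rdistrib inner_add_right * pos_def_def add_pos_nonneg)
    ultimately show ?case
      using insert.hyps by (simp add: pos_def_def add_ac)
  qed
\<comment> \<open>A sum over an infinite set is 0 by convention, so only \<open>A\<close>
  remains.\<close>
qed (use assms in simp)

text \<open>Each diagonal entry of the inverse is a value of the quadratic form: with y = A^-1 e_k
  it equals y_k = y . A y.\<close>

lemma trace_matrix_inv_pos:
  fixes A :: "real^'d^'d::finite"
  assumes "pos_def A"
  shows "trace (matrix_inv A) > 0"
proof -
  have "A *v x = 0 \<Longrightarrow> x = 0" for x
    using assms by (force simp: pos_def_def)
  then obtain B where "A ** B = mat 1"
    using matrix_left_invertible_ker matrix_left_right_inverse by metis
  then have inv: "A ** matrix_inv A = mat 1"
    by (simp add: matrix_inv_eqI)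
  have "matrix_inv A $ k $ k > 0" for k
  proof -
    define y where "y = matrix_inv A *v axis k 1"
    have Ay: "A *v y = axis k 1"
      by (simp add: y_def matrix_vector_mul_assoc inv)
    then have "y \<noteq> 0"
      by (metis axis_eq_0_iff matrix_vector_mult_0_right zero_neq_one)
    then have "y \<bullet> (A *v y) > 0"
      using assms by (simp add: pos_def_def)
    then have "y $ k > 0"
      by (simp add: Ay inner_axis)
    then show ?thesis
      by (simp add: y_def matrix_vector_mult_basis column_def)
  qed
  then show ?thesis
    by (simp add: trace_def sum_pos)
qed

section \<open>The instance and its quadratic forms\<close>

locale hadamard_instance =
  fixes H :: "real^'d::finite^'d" and pos :: "'d \<Rightarrow> nat" and h :: real
  assumes hadamard: "hadamard_matrix H"
    and pos: "bij_betw pos UNIV {1..CARD('d)}"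
    and h: "h > 0"
    and d: "CARD('d) \<ge> 4"
begin

text \<open>\<open>pos\<close> numbers the coordinates in an arbitrary order. Along it the weights
  decrease strictly, so no two axis vectors tie, yet the first is only twice the last.\<close>

definition weight :: "nat \<Rightarrow> real" where
  "weight i = 2 * real CARD('d) - 1 - real i"

definition coord :: "nat \<Rightarrow> 'd" where
  "coord = the_inv_into UNIV pos"

definition \<Lambda> :: "real^'d^'d" where
  "\<Lambda> = diag_mat (\<lambda>k. 1 / weight (pos k))"

text \<open>Dividing by the root of the weight applies \<open>\<Lambda>\<close>^(1/2) to the vectors
  w. The axis vectors have indices 1 to d, the columns of \<open>H\<close> have d + 1 to 2d; index 0
  lies outside the ground set.\<close>

definition v :: "nat \<Rightarrow> real^'d" where
  "v i = (if i \<le> CARD('d) then axis (coord i) (2 / sqrt (weight i))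
          else (\<chi> k. sqrt (h / (CARD('d) * weight (pos k))) * H $ k $ coord (i - CARD('d))))"

lemma coord_pos [simp]: "coord (pos k) = k"
  using pos by (simp add: coord_def bij_betw_def the_inv_into_f_f)

lemma pos_coord: "i \<in> {1..CARD('d)} \<Longrightarrow> pos (coord i) = i"
  using pos by (simp add: coord_def bij_betw_def f_the_inv_into_f)

lemma pos_range: "1 \<le> pos k" "pos k \<le> CARD('d)"
  using bij_betw_apply [OF pos, of k] by auto

lemma weight_pos: "i \<le> CARD('d) \<Longrightarrow> weight i > 0"
  using d unfolding weight_def by linarith

lemma weight_pos' [simp]: "weight (pos k) > 0"
  using weight_pos pos_range by blast

lemma sum_pos_reindex: "(\<Sum>k\<in>UNIV. F (pos k)) = (\<Sum>i=1..CARD('d). F i :: real)"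
  by (rule sum.reindex_bij_betw [OF pos])

lemma H_sq: "(H $ i $ j)\<^sup>2 = 1"
  using hadamard by (auto simp: hadamard_matrix_def power2_eq_1_iff)

text \<open>Squaring removes the signs, so a diagonal design cannot tell the columns of
  \<open>H\<close> apart.\<close>

lemma hadamard_nth_sq:
  "i > CARD('d) \<Longrightarrow> (v i $ k)\<^sup>2 = h / (CARD('d) * weight (pos k))"
  using h by (simp add: v_def power_mult_distrib H_sq less_imp_le)

lemma pos_def_\<Lambda>: "pos_def \<Lambda>"
  unfolding \<Lambda>_def by (rule pos_def_diag_mat) simp

lemma cost_pos: "design_cost \<Lambda> v S > 0"
  unfolding design_cost_def by (intro trace_matrix_inv_pos pos_def_add_outer_prods pos_def_\<Lambda>)

lemma inv_\<Lambda>: "matrix_inv \<Lambda> = diag_mat (\<lambda>k. weight (pos k))"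
  unfolding \<Lambda>_def by (subst matrix_inv_diag_mat) auto

lemma quadratic_form: "v i \<bullet> (matrix_inv \<Lambda> *v v i) = (\<Sum>k\<in>UNIV. weight (pos k) * (v i $ k)\<^sup>2)"
  by (simp add: inner_vec_def inv_\<Lambda> diag_mat_mult_vec power2_eq_square mult_ac)

lemma quadratic_form_axis:
  assumes "i \<in> {1..CARD('d)}"
  shows "v i \<bullet> (matrix_inv \<Lambda> *v v i) = 4"
proof -
  have "weight (pos k) * (v i $ k)\<^sup>2 = (if k = coord i then 4 else 0)" for k
    using assms weight_pos [of i] by (auto simp: v_def axis_def power_divide pos_coord)
  then show ?thesis
    by (simp add: quadratic_form)
qed

lemma quadratic_form_hadamard:
  assumes "i > CARD('d)"
  shows "v i \<bullet> (matrix_inv \<Lambda> *v v i) = h"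
proof -
  have "weight (pos k) * (v i $ k)\<^sup>2 = h / CARD('d)" for k
    using assms less_imp_neq [OF weight_pos', of k] by (simp add: hadamard_nth_sq)
  then show ?thesis
    by (simp add: quadratic_form)
qed

lemma Max_quadratic_form:
  "Max ((\<lambda>i. v i \<bullet> (matrix_inv \<Lambda> *v v i)) ` {1..2 * CARD('d)}) = max h 4"
proof -
  have split: "{1..2 * CARD('d)} = {1..CARD('d)} \<union> {CARD('d)<..2 * CARD('d)}" by auto
  have "(\<lambda>i. v i \<bullet> (matrix_inv \<Lambda> *v v i)) ` {1..CARD('d)} = {4}"
    using d by (subst image_cong [OF refl quadratic_form_axis]) (auto simp: image_constant_conv)
  moreover have "(\<lambda>i. v i \<bullet> (matrix_inv \<Lambda> *v v i)) ` {CARD('d)<..2 * CARD('d)} = {h}"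
    using d by (subst image_cong [OF refl quadratic_form_hadamard]) (auto simp: image_constant_conv)
  ultimately have "(\<lambda>i. v i \<bullet> (matrix_inv \<Lambda> *v v i)) ` {1..2 * CARD('d)} = {4, h}"
    unfolding split image_Un by auto
  then show ?thesis by (simp add: max.commute)
qed

section \<open>Costs of axis sets and of the whole Hadamard family\<close>

definition c :: "nat set \<Rightarrow> nat \<Rightarrow> real" where
  "c S i = (if i \<in> S then 5 else 1)"

lemma c_pos [simp]: "c S i > 0"
  by (simp add: c_def)

text \<open>\<open>c\<close> is the factor by which \<open>S\<close> enlarges each diagonal entry of
  \<open>\<Lambda>\<close>; the 5 is 1 + 2^2, from the vector 2 e_k.\<close>

lemma design_axis:
  assumes S: "S \<subseteq> {1..CARD('d)}"
  shows "\<Lambda> + (\<Sum>i\<in>S. outer_prod (v i)) = diag_mat (\<lambda>k. c S (pos k) / weight (pos k))"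
proof -
  have "finite S" using S finite_subset by blast
  have "(\<Sum>i\<in>S. v i $ k * v i $ l) = (if k = l \<and> pos k \<in> S then 4 / weight (pos k) else 0)" for k l
  proof -
    have "v i $ k * v i $ l = (if i = pos k then (if k = l then 4 / weight (pos k) else 0) else 0)"
      if "i \<in> S" for i
    proof -
      have "i \<in> {1..CARD('d)}" using S that by blast
      then show ?thesis
        using weight_pos' [of k] pos_coord [of i] by (auto simp: v_def axis_def abs_of_pos)
    qed
    then have "(\<Sum>i\<in>S. v i $ k * v i $ l) =
        (\<Sum>i\<in>S. if i = pos k then (if k = l then 4 / weight (pos k) else 0) else 0)"
      by (intro sum.cong) auto
    then show ?thesis
      using \<open>finite S\<close> by auto
  qed
  then show ?thesis
    by (auto simp: vec_eq_iff \<Lambda>_def c_def add_divide_distrib [symmetric])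
qed

lemma cost_axis:
  assumes "S \<subseteq> {1..CARD('d)}"
  shows "design_cost \<Lambda> v S = (\<Sum>i=1..CARD('d). weight i / c S i)"
  unfolding design_cost_def design_axis [OF assms]
  by (subst matrix_inv_diag_mat) (auto simp: trace_def sum_pos_reindex [of "\<lambda>i. weight i / c S i"])

lemma cost_axis_all: "design_cost \<Lambda> v {1..CARD('d)} = (\<Sum>i=1..CARD('d). weight i) / 5"
  unfolding cost_axis [OF order_refl] sum_divide_distrib
  by (intro sum.cong) (auto simp: c_def)

text \<open>Orthogonality of the rows of \<open>H\<close> cancels the off-diagonal entries, and the
  family adds h times \<open>\<Lambda>\<close> to \<open>\<Lambda>\<close>.\<close>

lemma cost_hadamard_all:
  "design_cost \<Lambda> v {CARD('d)<..2 * CARD('d)} = (\<Sum>i=1..CARD('d). weight i) / (1 + h)"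
proof -
  have "(\<Sum>i\<in>{CARD('d)<..2 * CARD('d)}. v i $ k * v i $ l) = (if k = l then h / weight (pos k) else 0)" for k l
  proof -
    have HH: "(\<Sum>j\<in>UNIV. H $ k $ j * H $ l $ j) = (if k = l then real CARD('d) else 0)"
    proof -
      have "(H ** transpose H) $ k $ l = mat (real CARD('d)) $ k $ l"
        using hadamard by (simp add: hadamard_matrix_def)
      then show ?thesis by (simp add: matrix_matrix_mult_def transpose_def mat_def)
    qed
    let ?s = "\<lambda>k. sqrt (h / (CARD('d) * weight (pos k)))"
    have "(\<Sum>i\<in>{CARD('d)<..2 * CARD('d)}. v i $ k * v i $ l) =
        (\<Sum>j\<in>UNIV. v (pos j + CARD('d)) $ k * v (pos j + CARD('d)) $ l)"
    proof (rule sum.reindex_bij_betw [symmetric])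
      have "bij_betw (\<lambda>i. i + CARD('d)) {1..CARD('d)} {CARD('d)<..2 * CARD('d)}"
        by (rule bij_betwI [where g = "\<lambda>i. i - CARD('d)"]) auto
      from bij_betw_trans [OF pos this] show "bij_betw (\<lambda>j. pos j + CARD('d)) UNIV {CARD('d)<..2 * CARD('d)}"
        by (simp add: comp_def)
    qed
    \<comment> \<open>Since \<open>pos\<close> starts at 1, the shifted indices exceed d and select
      the Hadamard branch of \<open>v\<close>.\<close>
    also have "\<dots> = (\<Sum>j\<in>UNIV. (?s k * ?s l) * (H $ k $ j * H $ l $ j))"
      using pos_range(1) by (intro sum.cong)
        (auto simp: v_def mult_ac Suc_le_eq not_less [symmetric] less_imp_neq [THEN not_sym])
    also have "\<dots> = (?s k * ?s l) * (if k = l then real CARD('d) else 0)"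
      by (simp only: sum_distrib_left [symmetric] HH)
    also have "\<dots> = (if k = l then h / weight (pos k) else 0)"
      using h by (simp add: less_imp_le)
    finally show ?thesis .
  qed
  then have "\<Lambda> + (\<Sum>i\<in>{CARD('d)<..2 * CARD('d)}. outer_prod (v i)) = diag_mat (\<lambda>k. (1 + h) / weight (pos k))"
    by (auto simp: vec_eq_iff \<Lambda>_def add_divide_distrib)
  moreover have "(1 + h) / weight (pos k) > 0" for k
    using h by simp
  ultimately show ?thesis
    by (simp add: design_cost_def matrix_inv_diag_mat trace_def sum_divide_distrib
        sum_pos_reindex [of "\<lambda>i. weight i / (1 + h)"])
qed

section \<open>Marginal gains and the course of greedy\<close>

lemma sum_weight_prefix:
  "t \<le> CARD('d) \<Longrightarrow> (\<Sum>i=1..t. weight i) = t * (2 * real CARD('d) - 1) - t * (t + 1) / 2"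
  by (induction t) (auto simp: weight_def field_simps)

lemma sum_split_prefix:
  assumes "t \<le> CARD('d)"
  shows "(\<Sum>i=1..CARD('d). F i) = (\<Sum>i=1..t. F i) + (\<Sum>i=t+1..CARD('d). F i :: real)"
  using assms by (metis add.commute le_add1 sum.ub_add_nat le_add_diff_inverse)

text \<open>This sum and the next one govern the denominator and the numerator of a Hadamard
  vector's gain after \<open>t\<close> axis vectors. A covered coordinate loses 1 - 1/5 here and the
  fraction 1 - 1/25 there.\<close>

lemma sum_inverse_c:
  assumes "t \<le> CARD('d)"
  shows "(\<Sum>i=1..CARD('d). 1 / c {1..t} i) = real CARD('d) - 4 * real t / 5"
  unfolding sum_split_prefix [OF assms] using assms
  by (simp add: c_def of_nat_diff)

lemma sum_weight_c2:
  assumes "t \<le> CARD('d)"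
  shows "(\<Sum>i=1..CARD('d). weight i / (c {1..t} i)\<^sup>2) = (\<Sum>i=1..CARD('d). weight i) - 24 / 25 * (\<Sum>i=1..t. weight i)"
  unfolding sum_split_prefix [OF assms]
  by (simp add: c_def sum_divide_distrib [symmetric])

text \<open>The weights decrease fast enough for the first axis vector to beat a Hadamard vector, and
  slowly enough for the contribution of the coordinates already covered to remain small.\<close>

lemma sum_weight_c2_le:
  assumes "t < CARD('d)"
  shows "(\<Sum>i=1..CARD('d). weight i / (c {1..t} i)\<^sup>2)
    \<le> 4 / 5 * weight (Suc t) * (\<Sum>i=1..CARD('d). 1 / c {1..t} i)"
proof -
  define x where "x = real CARD('d)"
  define y where "y = real t"
  have x: "x \<ge> 4" using d by (simp add: x_def)
  \<comment> \<open>25 times the difference of the two sides of the claim is a quadratic in y.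
    Completing the square gives (2y - (x + 1))^2 plus (3x^2 - 9x - 2)/2, and this remainder is
    nonnegative because d is at least 4; at d = 3 it would be -1.\<close>
  have "0 \<le> (x - 4) * (3 * x + 3) + 10"
    using x by simp
  then have "0 \<le> (2 * y - (x + 1))\<^sup>2 + ((x - 4) * (3 * x + 3) + 10) / 2"
    by simp
  then have "(x * (2 * x - 1) - x * (x + 1) / 2) - 24 / 25 * (y * (2 * x - 1) - y * (y + 1) / 2)
      \<le> 4 / 5 * (2 * x - 2 - y) * (x - 4 * y / 5)"
    using x by (simp add: field_simps power2_eq_square)
  then show ?thesis
    unfolding sum_weight_c2 [OF less_imp_le [OF assms]] sum_inverse_c [OF less_imp_le [OF assms]]
      sum_weight_prefix [OF less_imp_le [OF assms]] sum_weight_prefix [OF order_refl]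
    by (simp add: x_def y_def weight_def diff_diff_eq)
qed

text \<open>Covering coordinate \<open>j\<close> divides its contribution to the trace by 5.\<close>

lemma cost_axis_step:
  assumes "S \<subseteq> {1..CARD('d)}" "j \<in> {1..CARD('d)} - S"
  shows "design_cost \<Lambda> v (insert j S) = design_cost \<Lambda> v S - 4 / 5 * weight j"
proof -
  have "weight i / c (insert j S) i = weight i / c S i - (if i = j then 4 / 5 * weight j else 0)" for i
    using assms by (auto simp: c_def)
  then show ?thesis
    using assms by (simp add: cost_axis sum_subtractf)
qed

text \<open>With P and Q as abbreviated below, the gain is (h/d) P / (1 + (h/d) Q). For every h this
  stays below P / Q, which \<open>sum_weight_c2_le\<close> bounds by the gain of the next axis
  vector.\<close>

lemma cost_hadamard_step:
  assumes "t < CARD('d)" "j > CARD('d)"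
  shows "design_cost \<Lambda> v ({1..t} \<union> {j}) > design_cost \<Lambda> v {1..t} - 4 / 5 * weight (Suc t)"
proof -
  let ?m = "\<lambda>k. c {1..t} (pos k) / weight (pos k)"
  let ?P = "\<Sum>i=1..CARD('d). weight i / (c {1..t} i)\<^sup>2" and ?Q = "\<Sum>i=1..CARD('d). 1 / c {1..t} i"
  have "\<Lambda> + (\<Sum>i\<in>{1..t} \<union> {j}. outer_prod (v i)) = diag_mat ?m + outer_prod (v j)"
    using assms by (subst design_axis [symmetric]) (auto simp: add_ac)
  then have "design_cost \<Lambda> v ({1..t} \<union> {j}) = (\<Sum>k\<in>UNIV. 1 / ?m k) -
      (\<Sum>k\<in>UNIV. (v j $ k / ?m k)\<^sup>2) / (1 + (\<Sum>k\<in>UNIV. (v j $ k)\<^sup>2 / ?m k))"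
    by (simp add: design_cost_def sherman_morrison_trace_diag_mat)
  also have "(\<Sum>k\<in>UNIV. 1 / ?m k) = design_cost \<Lambda> v {1..t}"
    using assms sum_pos_reindex [of "\<lambda>i. weight i / c {1..t} i"] by (simp add: cost_axis)
  also have "(\<Sum>k\<in>UNIV. (v j $ k / ?m k)\<^sup>2) = (\<Sum>k\<in>UNIV. h / CARD('d) * (weight (pos k) / (c {1..t} (pos k))\<^sup>2))"
    using assms less_imp_neq [OF weight_pos']
    by (intro sum.cong)
      (auto simp: power_divide power_mult_distrib hadamard_nth_sq power2_eq_square [of "weight _"])
  also have "\<dots> = h / CARD('d) * ?P"
    by (simp only: sum_distrib_left [symmetric] sum_pos_reindex [of "\<lambda>i. weight i / (c {1..t} i)\<^sup>2"])
  also have "(\<Sum>k\<in>UNIV. (v j $ k)\<^sup>2 / ?m k) = (\<Sum>k\<in>UNIV. h / CARD('d) * (1 / c {1..t} (pos k)))"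
    using assms less_imp_neq [OF weight_pos']
    by (intro sum.cong) (auto simp: hadamard_nth_sq)
  also have "\<dots> = h / CARD('d) * ?Q"
    by (simp only: sum_distrib_left [symmetric] sum_pos_reindex [of "\<lambda>i. 1 / c {1..t} i"])
  finally have cost: "design_cost \<Lambda> v ({1..t} \<union> {j}) =
      design_cost \<Lambda> v {1..t} - h / CARD('d) * ?P / (1 + h / CARD('d) * ?Q)" .
  have W: "weight (Suc t) > 0"
    using assms weight_pos by auto
  have hd: "h / CARD('d) > 0" using h by simp
  have "?Q \<ge> 0"
    by (intro sum_nonneg) (simp add: less_imp_le)
  then have Q: "1 + h / CARD('d) * ?Q > 0"
    using hd by (intro add_pos_nonneg mult_nonneg_nonneg) auto
  have "h / CARD('d) * ?P \<le> h / CARD('d) * (4 / 5 * weight (Suc t) * ?Q)"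
    using sum_weight_c2_le [OF assms(1)] hd by (intro mult_left_mono) auto
  \<comment> \<open>The summand 1 makes the inequality strict, however large h is.\<close>
  also have "\<dots> < 4 / 5 * weight (Suc t) * (1 + h / CARD('d) * ?Q)"
    using W by (simp add: algebra_simps)
  finally have "h / CARD('d) * ?P / (1 + h / CARD('d) * ?Q) < 4 / 5 * weight (Suc t)"
    by (subst pos_divide_less_eq [OF Q])
  then show ?thesis using cost by simp
qed

text \<open>At each step the next axis vector is strictly better than every competitor, so
  tie-breaking never occurs and the run is unique.\<close>

lemma greedy_run_prefix:
  assumes "greedy_run (design_cost \<Lambda> v) {1..2 * CARD('d)} t S" "t \<le> CARD('d)"
  shows "S = {1..t}"
  using assms
proof (induction rule: greedy_run.induct)
  case init
  then show ?case by simp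
next
  case (step t S i)
  then have S: "S = {1..t}" and t: "t < CARD('d)" by auto
  have i: "i \<in> {1..2 * CARD('d)} - {1..t}"
    using step.hyps(2) by (simp only: S is_arg_min_def)
  have min: "\<not> design_cost \<Lambda> v ({1..t} \<union> {j}) < design_cost \<Lambda> v ({1..t} \<union> {i})"
      if "j \<in> {1..2 * CARD('d)} - {1..t}" for j
    using step.hyps(2) that unfolding S is_arg_min_def by blast
  have Suc: "{1..t} \<union> {Suc t} = {1..Suc t}" by auto
  have "i = Suc t"
  proof (rule ccontr)
    assume ne: "i \<noteq> Suc t"
    have "design_cost \<Lambda> v ({1..t} \<union> {Suc t}) < design_cost \<Lambda> v ({1..t} \<union> {i})"
    \<comment> \<open>A later axis vector loses by its smaller weight, a Hadamard vector by the gain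
      bound.\<close>
    proof (cases "i \<le> CARD('d)")
      case True
      then have "weight i < weight (Suc t)"
        using i ne by (auto simp: weight_def)
      then show ?thesis
        using True i t by (simp add: cost_axis_step)
    next
      case False
      then show ?thesis
        using cost_hadamard_step [OF t, of i] t by (simp add: cost_axis_step)
    qed
    with min [of "Suc t"] t show False by simp
  qed
  then show ?case using S Suc by simp
qed

end

section \<open>Greedy compared with the optimum\<close>

theorem theorem2:
  fixes h :: real
  assumes "h > 0"
    and "CARD('d::finite) \<ge> 4"
    and "\<exists>H :: real^'d^'d. hadamard_matrix H"
  shows "\<exists>(\<Lambda> :: real^'d^'d) (v :: nat \<Rightarrow> real^'d).
    pos_def \<Lambda> \<and>
    Max ((\<lambda>i. v i \<bullet> (matrix_inv \<Lambda> *v v i)) ` {1..2 * CARD('d)}) = max h 4 \<and>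
    (\<forall>S_greedy S_star.
      greedy_run (design_cost \<Lambda> v) {1..2 * CARD('d)} CARD('d) S_greedy \<longrightarrow>
      is_arg_min (design_cost \<Lambda> v) (\<lambda>S. S \<subseteq> {1..2 * CARD('d)} \<and> card S = CARD('d)) S_star \<longrightarrow>
      design_cost \<Lambda> v S_greedy / design_cost \<Lambda> v S_star \<ge> (1 + h) / 5)"
proof -
  obtain H :: "real^'d^'d" where H: "hadamard_matrix H"
    using assms(3) by blast
  obtain pos :: "'d \<Rightarrow> nat" where pos: "bij_betw pos UNIV {1..CARD('d)}"
    using finite_same_card_bij [of "UNIV :: 'd set" "{1..CARD('d)}"] by auto
  interpret hadamard_instance H pos h
    using H pos assms by unfold_locales auto
  have "design_cost \<Lambda> v S / design_cost \<Lambda> v S' \<ge> (1 + h) / 5"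
    if S: "greedy_run (design_cost \<Lambda> v) {1..2 * CARD('d)} CARD('d) S"
      and S': "is_arg_min (design_cost \<Lambda> v) (\<lambda>S. S \<subseteq> {1..2 * CARD('d)} \<and> card S = CARD('d)) S'" for S S'
  proof -
    let ?T = "\<Sum>i=1..CARD('d). weight i"
    \<comment> \<open>The Hadamard family has d members and is thus feasible; its cost bounds the
      optimum from above, which bounds the ratio from below.\<close>
    have "design_cost \<Lambda> v S' \<le> design_cost \<Lambda> v {CARD('d)<..2 * CARD('d)}"
      using S' unfolding is_arg_min_linorder by (auto dest!: spec [of _ "{CARD('d)<..2 * CARD('d)}"])
    then have "design_cost \<Lambda> v S' * (1 + h) \<le> ?T"
      using h unfolding cost_hadamard_all by (simp add: pos_le_divide_eq)
    moreover have "design_cost \<Lambda> v S = ?T / 5"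
      using greedy_run_prefix [OF S] cost_axis_all by simp
    ultimately show ?thesis
      using cost_pos [of S'] by (simp add: field_simps)
  qed
  then show ?thesis
    using pos_def_\<Lambda> Max_quadratic_form by (intro exI [of _ \<Lambda>] exI [of _ v]) blast
qed

end
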